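(* Let $\mathcal{P}$ be a well-formed integer program, let $\alpha\in\mathcal{P}$, let $\mathit{tv}$ be a temporary variable of $\alpha$, and let $b$ be an arithmetic expression such that $b\sigma\in\mathbb{Z}$ for every integer substitution $\sigma$ with $\sigma\models\alpha\{\mathit{tv}/b\}$. Let $\mathcal{P}' = \mathcal{P}\cup\{\alpha\{\mathit{tv}/b\}\}$. Then $\mathcal{P}'$ is well formed and the processor mapping $\mathcal{P}$ to $\mathcal{P}'$ is sound.
   Context: Fix a finite set $\Sigma$ of function symbols of common arity $k$ containing a start symbol $f_0$, and variables ranging over $\mathbb{Z}$. Arithmetic expressions are built from variables, numbers and operations such as $+,-,\cdot$, division, exponentiation; a constraint is a finite conjunction of inequations ($<,\leq,>,\geq$) between arithmetic expressions. A rule has the form $f(\vec x)\xrightarrow{c}T\ [\varphi]$ where $\vec x=(x_1,\dots,x_k)$ is a fixed vector of pairwise different program variables, $f\in\Sigma$, $c$ is an arithmetic expression (cost), $T$ a finite multiset of terms $g(t_1,\dots,t_k)$ ($g\in\Sigma$, $t_i$ arithmetic expressions), and $\varphi$ a constraint (guard); notation $\mathrm{lhs},\mathrm{rhs},\mathrm{cost},\mathrm{guard}$; variables of a rule not in $\vec x$ are its temporary variables. An integer program is a finite set of rules in which $f_0$ does not occur on right-hand sides. Substitutions map variables to arithmetic expressions, applied homomorphically; $\alpha\{\mathit{tv}/b\}$ is the rule obtained by replacing $\mathit{tv}$ by $b$ everywhere in $\alpha$. An integer substitution maps variables of its domain to integers; $\sigma\models\alpha$ means all variables of $\alpha$ are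 in $\mathrm{dom}(\sigma)$ and $\sigma$ models $\mathrm{guard}(\alpha)$. A configuration is a finite multiset of terms $f(n_1,\dots,n_k)$, $n_i\in\mathbb{Z}$. $S\xrightarrow{k}_{\mathcal{P}}T$ if there are $s\in S$, a rule $f(\vec x)\xrightarrow{c}Q\ [\varphi]$ in $\mathcal{P}$ and an integer substitution $\sigma$ covering the rule's variables with $f(\vec x)\sigma=s$, $\sigma\models\varphi$, $c\sigma=k$, $T=(S\setminus\{s\})\cup Q\sigma$ (multisets; equality modulo arithmetic); costs of sequences of steps are summed. $\mathrm{dh}_{\mathcal{P}}(S)=\sup\{k\mid S\xrightarrow{k}{}^{*}_{\mathcal{P}}T\}$, $\mathrm{rc}_{\mathcal{P}}(n)=\sup\{\mathrm{dh}_{\mathcal{P}}(f_0(\vec n))\mid\vec n\in\mathbb{Z}^k,\sum_i|n_i|\leq n\}$. A rule $\alpha$ is well formed if $t_i\sigma\in\mathbb{Z}$ for all $f(t_1,\dots,t_k)\in\mathrm{rhs}(\alpha)$, all $i$, and all integer substitutions $\sigma\models\alpha$; a program is well formed if all its rules are. A processor is a partial function on integer programs; it is sound if $\mathrm{rc}_{\mathcal{P}}(n)\geq\mathrm{rc}_{\mathrm{proc}(\mathcal{P})}(n)$ for all $n\in\mathbb{N}$ and all $\mathcal{P}$ where it is defined. *)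

theory Defs
  imports Complex_Main "HOL-Library.Multiset" "HOL-Library.Extended_Real"
begin

datatype (vars_aexp: 'v) aexp =
    Var 'v
  | Num real
  | Add "'v aexp" "'v aexp"
  | Sub "'v aexp" "'v aexp"
  | Mul "'v aexp" "'v aexp"
  | Div "'v aexp" "'v aexp"
  | Pow "'v aexp" "'v aexp"

datatype 'e ineq = Lt 'e 'e | Le 'e 'e | Gt 'e 'e | Ge 'e 'e

type_synonym 'v constr = "'v aexp ineq list"

text \<open>A pair \<open>(f, [t\<^sub>1, \<dots>, t\<^sub>k])\<close> stands for \<open>f(t\<^sub>1, \<dots>, t\<^sub>k)\<close>; the arguments are arithmetic
  expressions in rules and integers in configurations.\<close>

type_synonym ('f, 'e) fterm = "'f \<times> 'e list"

datatype (syms_rule: 'f, vars_rule: 'v) rule =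
  Rule (lhs: "('f, 'v aexp) fterm") (cost: "'v aexp")
       (rhs: "('f, 'v aexp) fterm multiset") (guard: "'v constr")

type_synonym ('f, 'v) program = "('f, 'v) rule set"
type_synonym 'f config = "('f, int) fterm multiset"


subsection \<open>Substitutions\<close>

primrec subst :: "('v \<Rightarrow> 'w aexp) \<Rightarrow> 'v aexp \<Rightarrow> 'w aexp" where
  "subst \<theta> (Var x) = \<theta> x"
| "subst \<theta> (Num r) = Num r"
| "subst \<theta> (Add s t) = Add (subst \<theta> s) (subst \<theta> t)"
| "subst \<theta> (Sub s t) = Sub (subst \<theta> s) (subst \<theta> t)"
| "subst \<theta> (Mul s t) = Mul (subst \<theta> s) (subst \<theta> t)"
| "subst \<theta> (Div s t) = Div (subst \<theta> s) (subst \<theta> t)"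
| "subst \<theta> (Pow s t) = Pow (subst \<theta> s) (subst \<theta> t)"

definition subst_fterm :: "('v \<Rightarrow> 'w aexp) \<Rightarrow> ('f, 'v aexp) fterm \<Rightarrow> ('f, 'w aexp) fterm" where
  "subst_fterm \<theta> = map_prod id (map (subst \<theta>))"

definition subst_rule :: "('v \<Rightarrow> 'w aexp) \<Rightarrow> ('f, 'v) rule \<Rightarrow> ('f, 'w) rule" where
  "subst_rule \<theta> \<alpha> =
     Rule (subst_fterm \<theta> (lhs \<alpha>)) (subst \<theta> (cost \<alpha>))
          (image_mset (subst_fterm \<theta>) (rhs \<alpha>)) (map (map_ineq (subst \<theta>)) (guard \<alpha>))"

definition instantiate :: "('f, 'v) rule \<Rightarrow> 'v \<Rightarrow> 'v aexp \<Rightarrow> ('f, 'v) rule" where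
  "instantiate \<alpha> tv b = subst_rule (Var(tv := b)) \<alpha>"


subsection \<open>Evaluation under integer substitutions\<close>

text \<open>An integer substitution is a partial map \<open>'v \<rightharpoonup> int\<close>. Values of expressions are real numbers;
  evaluation is strict, and \<open>None\<close> stands for an undefined value, e.g. a division by zero.\<close>

definition div_val :: "real \<Rightarrow> real \<Rightarrow> real option" where
  "div_val x y = (if y = 0 then None else Some (x / y))"

text \<open>\<open>powr\<close> alone would be wrong for negative bases and for \<open>0\<^sup>0 = 1\<close>, hence the separate case
  for integer exponents. Undefined are \<open>0\<close> to a negative exponent and negative bases with
  non-integer exponents.\<close>

definition pow_val :: "real \<Rightarrow> real \<Rightarrow> real option" where
  "pow_val x y =
     (if y \<in> \<int> \<and> (x \<noteq> 0 \<or> 0 \<le> y) then Some (x powi \<lfloor>y\<rfloor>)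
      else if 0 < x \<or> x = 0 \<and> 0 < y then Some (x powr y)
      else None)"

definition lift2 ::
  "(real \<Rightarrow> real \<Rightarrow> real option) \<Rightarrow> real option \<Rightarrow> real option \<Rightarrow> real option" where
  "lift2 g u v = Option.bind u (\<lambda>x. Option.bind v (g x))"

primrec eval :: "('v \<rightharpoonup> int) \<Rightarrow> 'v aexp \<Rightarrow> real option" where
  "eval \<sigma> (Var x) = map_option real_of_int (\<sigma> x)"
| "eval \<sigma> (Num r) = Some r"
| "eval \<sigma> (Add s t) = lift2 (\<lambda>x y. Some (x + y)) (eval \<sigma> s) (eval \<sigma> t)"
| "eval \<sigma> (Sub s t) = lift2 (\<lambda>x y. Some (x - y)) (eval \<sigma> s) (eval \<sigma> t)"
| "eval \<sigma> (Mul s t) = lift2 (\<lambda>x y. Some (x * y)) (eval \<sigma> s) (eval \<sigma> t)"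
| "eval \<sigma> (Div s t) = lift2 div_val (eval \<sigma> s) (eval \<sigma> t)"
| "eval \<sigma> (Pow s t) = lift2 pow_val (eval \<sigma> s) (eval \<sigma> t)"

definition evals_to_int :: "('v \<rightharpoonup> int) \<Rightarrow> 'v aexp \<Rightarrow> int \<Rightarrow> bool" where
  "evals_to_int \<sigma> t n \<longleftrightarrow> eval \<sigma> t = Some (real_of_int n)"

definition fterm_evals_to :: "('v \<rightharpoonup> int) \<Rightarrow> ('f, 'v aexp) fterm \<Rightarrow> ('f, int) fterm \<Rightarrow> bool" where
  "fterm_evals_to \<sigma> = rel_prod (=) (list_all2 (evals_to_int \<sigma>))"

definition holds2 :: "(real \<Rightarrow> real \<Rightarrow> bool) \<Rightarrow> real option \<Rightarrow> real option \<Rightarrow> bool" where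
  "holds2 R u v \<longleftrightarrow> (\<exists>x y. u = Some x \<and> v = Some y \<and> R x y)"

primrec models_ineq :: "('v \<rightharpoonup> int) \<Rightarrow> 'v aexp ineq \<Rightarrow> bool" where
  "models_ineq \<sigma> (Lt s t) \<longleftrightarrow> holds2 (<) (eval \<sigma> s) (eval \<sigma> t)"
| "models_ineq \<sigma> (Le s t) \<longleftrightarrow> holds2 (\<le>) (eval \<sigma> s) (eval \<sigma> t)"
| "models_ineq \<sigma> (Gt s t) \<longleftrightarrow> holds2 (>) (eval \<sigma> s) (eval \<sigma> t)"
| "models_ineq \<sigma> (Ge s t) \<longleftrightarrow> holds2 (\<ge>) (eval \<sigma> s) (eval \<sigma> t)"

definition models_constr :: "('v \<rightharpoonup> int) \<Rightarrow> 'v constr \<Rightarrow> bool" where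
  "models_constr \<sigma> \<phi> \<longleftrightarrow> (\<forall>c \<in> set \<phi>. models_ineq \<sigma> c)"

definition models_rule :: "('v \<rightharpoonup> int) \<Rightarrow> ('f, 'v) rule \<Rightarrow> bool" where
  "models_rule \<sigma> \<alpha> \<longleftrightarrow> vars_rule \<alpha> \<subseteq> dom \<sigma> \<and> models_constr \<sigma> (guard \<alpha>)"


subsection \<open>Integer programs\<close>

text \<open>The common arity of the symbols in \<open>Sig\<close> is the length of the vector \<open>xs\<close> of program
  variables.\<close>

definition is_fterm :: "'f set \<Rightarrow> nat \<Rightarrow> ('f, 'e) fterm \<Rightarrow> bool" where
  "is_fterm Sig k = (\<lambda>(f, ts). f \<in> Sig \<and> length ts = k)"

definition is_rule :: "'f set \<Rightarrow> 'v list \<Rightarrow> ('f, 'v) rule \<Rightarrow> bool" where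
  "is_rule Sig xs \<alpha> \<longleftrightarrow>
     (\<exists>f \<in> Sig. lhs \<alpha> = (f, map Var xs)) \<and> (\<forall>t \<in># rhs \<alpha>. is_fterm Sig (length xs) t)"

definition temp_vars :: "'v list \<Rightarrow> ('f, 'v) rule \<Rightarrow> 'v set" where
  "temp_vars xs \<alpha> = vars_rule \<alpha> - set xs"

definition integer_program :: "'f set \<Rightarrow> 'f \<Rightarrow> 'v list \<Rightarrow> ('f, 'v) program \<Rightarrow> bool" where
  "integer_program Sig f0 xs P \<longleftrightarrow>
     finite P \<and> (\<forall>\<alpha> \<in> P. is_rule Sig xs \<alpha> \<and> (\<forall>t \<in># rhs \<alpha>. fst t \<noteq> f0))"

definition well_formed_rule :: "('f, 'v) rule \<Rightarrow> bool" where
  "well_formed_rule \<alpha> \<longleftrightarrow>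
     (\<forall>\<sigma>. models_rule \<sigma> \<alpha> \<longrightarrow>
        (\<forall>(f, ts) \<in># rhs \<alpha>. \<forall>t \<in> set ts. \<exists>n. evals_to_int \<sigma> t n))"

definition well_formed_program :: "('f, 'v) program \<Rightarrow> bool" where
  "well_formed_program P \<longleftrightarrow> (\<forall>\<alpha> \<in> P. well_formed_rule \<alpha>)"


subsection \<open>Runtime complexity\<close>

definition step :: "('f, 'v) program \<Rightarrow> 'f config \<Rightarrow> real \<Rightarrow> 'f config \<Rightarrow> bool" where
  "step P S k T \<longleftrightarrow>
     (\<exists>s \<in># S. \<exists>\<alpha> \<in> P. \<exists>\<sigma> Q.
        vars_rule \<alpha> \<subseteq> dom \<sigma> \<and> fterm_evals_to \<sigma> (lhs \<alpha>) s \<and> models_constr \<sigma> (guard \<alpha>) \<and>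
        eval \<sigma> (cost \<alpha>) = Some k \<and>
        rel_mset (fterm_evals_to \<sigma>) (rhs \<alpha>) Q \<and> T = (S - {#s#}) + Q)"

inductive steps :: "('f, 'v) program \<Rightarrow> 'f config \<Rightarrow> real \<Rightarrow> 'f config \<Rightarrow> bool" for P where
  refl: "steps P S 0 S"
| step: "step P S k T \<Longrightarrow> steps P T l U \<Longrightarrow> steps P S (k + l) U"

definition dh :: "('f, 'v) program \<Rightarrow> 'f config \<Rightarrow> ereal" where
  "dh P S = Sup {ereal k | k T. steps P S k T}"

definition rc :: "'f \<Rightarrow> nat \<Rightarrow> ('f, 'v) program \<Rightarrow> nat \<Rightarrow> ereal" where
  "rc f0 k P n = Sup {dh P {#(f0, ns)#} | ns :: int list.
     length ns = k \<and> (\<Sum>m\<leftarrow>ns. \<bar>m\<bar>) \<le> int n}"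


subsection \<open>Processors\<close>

type_synonym ('f, 'v) processor = "('f, 'v) program \<rightharpoonup> ('f, 'v) program"

definition processor :: "'f set \<Rightarrow> 'f \<Rightarrow> 'v list \<Rightarrow> ('f, 'v) processor \<Rightarrow> bool" where
  "processor Sig f0 xs proc \<longleftrightarrow>
     (\<forall>P P'. proc P = Some P' \<longrightarrow> integer_program Sig f0 xs P \<and> integer_program Sig f0 xs P')"

definition sound_processor :: "'f set \<Rightarrow> 'f \<Rightarrow> 'v list \<Rightarrow> ('f, 'v) processor \<Rightarrow> bool" where
  "sound_processor Sig f0 xs proc \<longleftrightarrow>
     processor Sig f0 xs proc \<and>
     (\<forall>P P'. proc P = Some P' \<longrightarrow>
        (\<forall>n. rc f0 (length xs) P n \<ge> rc f0 (length xs) P' n))"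

end

theory Submission imports Defs begin

text \<open>If \<open>\<sigma>\<close> models \<open>\<alpha>{tv/b}\<close>, then \<open>b\<sigma>\<close> is an integer \<open>n\<close>, and evaluating \<open>\<alpha>{tv/b}\<close> under \<open>\<sigma>\<close> is the
  same as evaluating \<open>\<alpha>\<close> under \<open>\<sigma>(tv \<mapsto> n)\<close>. So well-formedness carries over from \<open>\<alpha>\<close>, and every step
  with the new rule is already a step with \<open>\<alpha>\<close>.\<close>

lemma vars_aexp_subst: "vars_aexp (subst \<theta> t) = (\<Union>x\<in>vars_aexp t. vars_aexp (\<theta> x))"
  by (induction t) auto

lemma set_ineq_map_subst:
  "\<Union> (vars_aexp ` set_ineq (map_ineq (subst \<theta>) c)) =
   (\<Union>x\<in>\<Union> (vars_aexp ` set_ineq c). vars_aexp (\<theta> x))"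
  by (cases c) (auto simp: vars_aexp_subst)

definition vars_fterm :: "('f, 'v aexp) fterm \<Rightarrow> 'v set" where
  "vars_fterm t = \<Union> (vars_aexp ` set (snd t))"

lemma vars_fterm_subst:
  "vars_fterm (subst_fterm \<theta> t) = (\<Union>x\<in>vars_fterm t. vars_aexp (\<theta> x))"
  by (auto simp: vars_fterm_def subst_fterm_def vars_aexp_subst)

text \<open>The generated \<open>vars_rule\<close> runs through the set functions of pairs, lists
  and inequations. Splitting it by the components of a rule lets the substitution lemmas for terms,
  cost and guard be applied one by one.\<close>

lemma vars_rule_conv:
  "vars_rule \<alpha> = vars_fterm (lhs \<alpha>) \<union> vars_aexp (cost \<alpha>) \<union> \<Union> (vars_fterm ` set_mset (rhs \<alpha>)) \<union>
     (\<Union>c\<in>set (guard \<alpha>). \<Union> (vars_aexp ` set_ineq c))"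
  by (cases \<alpha>) (simp add: vars_fterm_def prod_set_defs Un_assoc)

lemma vars_rule_subst:
  "vars_rule (subst_rule \<theta> \<alpha>) = (\<Union>x\<in>vars_rule \<alpha>. vars_aexp (\<theta> x))"
  unfolding vars_rule_conv
  by (simp add: subst_rule_def vars_fterm_subst vars_aexp_subst set_ineq_map_subst
      UN_Un UN_UN_flatten)

context
  fixes \<sigma> :: "'w \<rightharpoonup> int" and \<theta> :: "'v \<Rightarrow> 'w aexp" and \<tau> :: "'v \<rightharpoonup> int"
  assumes eval_\<theta>: "eval \<sigma> \<circ> \<theta> = map_option real_of_int \<circ> \<tau>"
begin

text \<open>The hypothesis \<open>eval_\<theta>\<close> equates partial functions:
  \<open>\<theta> x\<close> is undefined under \<open>\<sigma>\<close> exactly where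
  \<open>\<tau> x\<close> is. Hence the induction works for undefined values too, with no condition
  on the variables of \<open>t\<close>.\<close>

lemma eval_subst: "eval \<sigma> (subst \<theta> t) = eval \<tau> t"
  by (induction t) (simp_all add: fun_cong[OF eval_\<theta>, unfolded o_apply])

lemma evals_to_int_subst: "evals_to_int \<sigma> (subst \<theta> t) = evals_to_int \<tau> t"
  by (simp add: fun_eq_iff evals_to_int_def eval_subst)

lemma fterm_evals_to_subst: "fterm_evals_to \<sigma> (subst_fterm \<theta> t) = fterm_evals_to \<tau> t"
  by (cases t)
    (simp add: fun_eq_iff fterm_evals_to_def subst_fterm_def list.rel_map
      evals_to_int_subst)

lemma models_ineq_subst: "models_ineq \<sigma> (map_ineq (subst \<theta>) c) \<longleftrightarrow> models_ineq \<tau> c"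
  by (cases c) (auto simp: eval_subst)

lemma models_constr_subst:
  "models_constr \<sigma> (map (map_ineq (subst \<theta>)) \<phi>) \<longleftrightarrow> models_constr \<tau> \<phi>"
  by (simp add: models_constr_def models_ineq_subst)

end

text \<open>The witness is \<open>\<sigma>(tv \<mapsto> n)\<close>. The value \<open>n\<close> is
  computed under the old \<open>\<sigma>\<close>, so \<open>b\<close> may itself contain
  \<open>tv\<close>. The second property is the form in which the evaluation lemmas above use the
  witness.\<close>

lemma instantiate_int_substitution:
  assumes "vars_rule (instantiate \<alpha> tv b) \<subseteq> dom \<sigma>" and "evals_to_int \<sigma> b n"
  obtains \<tau> where "vars_rule \<alpha> \<subseteq> dom \<tau>"
    and "eval \<sigma> \<circ> Var(tv := b) = map_option real_of_int \<circ> \<tau>"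
proof
  show "vars_rule \<alpha> \<subseteq> dom (\<sigma>(tv \<mapsto> n))"
  proof
    fix x
    assume x: "x \<in> vars_rule \<alpha>"
    \<comment> \<open>Such an \<open>x\<close> is mapped to itself, so it survives in the instance
      and \<open>\<sigma>\<close> covers it; \<open>tv\<close> is covered by the update.\<close>
    have "x \<in> vars_rule (instantiate \<alpha> tv b)" if "x \<noteq> tv"
      unfolding instantiate_def vars_rule_subst using x that by (intro UN_I[of x]) auto
    with assms(1) show "x \<in> dom (\<sigma>(tv \<mapsto> n))" by auto
  qed
  show "eval \<sigma> \<circ> Var(tv := b) = map_option real_of_int \<circ> \<sigma>(tv \<mapsto> n)"
    using assms(2) by (simp add: fun_eq_iff evals_to_int_def)
qed

lemma well_formed_rule_instantiate:
  assumes "well_formed_rule \<alpha>"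
    and "\<And>\<sigma>. models_rule \<sigma> (instantiate \<alpha> tv b) \<Longrightarrow> \<exists>n. evals_to_int \<sigma> b n"
  shows "well_formed_rule (instantiate \<alpha> tv b)"
  unfolding well_formed_rule_def
proof (intro allI impI)
  fix \<sigma>
  assume \<sigma>: "models_rule \<sigma> (instantiate \<alpha> tv b)"
  with assms(2) obtain n where n: "evals_to_int \<sigma> b n" by blast
  have "vars_rule (instantiate \<alpha> tv b) \<subseteq> dom \<sigma>"
    using \<sigma> unfolding models_rule_def by (rule conjunct1)
  then obtain \<tau> where \<tau>: "vars_rule \<alpha> \<subseteq> dom \<tau>"
    and eq: "eval \<sigma> \<circ> Var(tv := b) = map_option real_of_int \<circ> \<tau>"
    using n by (rule instantiate_int_substitution)
  have "models_constr \<sigma> (map (map_ineq (subst (Var(tv := b)))) (guard \<alpha>))"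
    using \<sigma> unfolding models_rule_def instantiate_def subst_rule_def rule.sel by (rule conjunct2)
  with \<tau> have "models_rule \<tau> \<alpha>"
    by (simp add: models_rule_def models_constr_subst[OF eq])
  with assms(1) have "\<forall>(f, ts) \<in># rhs \<alpha>. \<forall>t \<in> set ts. \<exists>m. evals_to_int \<tau> t m"
    unfolding well_formed_rule_def by blast
  then show "\<forall>(f, ts) \<in># rhs (instantiate \<alpha> tv b). \<forall>t \<in> set ts. \<exists>m. evals_to_int \<sigma> t m"
    by (simp add: instantiate_def subst_rule_def subst_fterm_def case_prod_beta
        evals_to_int_subst[OF eq])
qed

text \<open>Substitution preserves root symbols and arities, so only the left-hand side is at stake.
  It stays the vector of program variables because \<open>tv\<close> is not among them.\<close>

lemma integer_program_insert_instantiate: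
  assumes "integer_program Sig f0 xs P" and "\<alpha> \<in> P" and "tv \<notin> set xs"
  shows "integer_program Sig f0 xs (insert (instantiate \<alpha> tv b) P)"
proof -
  have \<alpha>: "is_rule Sig xs \<alpha>" "\<forall>t \<in># rhs \<alpha>. fst t \<noteq> f0"
    using assms(1,2) by (auto simp: integer_program_def)
  have "map (subst (Var(tv := b)) \<circ> Var) xs = map Var xs"
    using assms(3) by (intro map_cong) auto
  with \<alpha> have "is_rule Sig xs (instantiate \<alpha> tv b)"
    by (auto simp: is_rule_def is_fterm_def instantiate_def subst_rule_def subst_fterm_def)
  moreover have "\<forall>t \<in># rhs (instantiate \<alpha> tv b). fst t \<noteq> f0"
    using \<alpha>(2) by (simp add: instantiate_def subst_rule_def subst_fterm_def)
  ultimately show ?thesis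
    using assms(1) by (auto simp: integer_program_def)
qed

lemma step_insert_instantiate:
  assumes "\<alpha> \<in> P"
    and "\<And>\<sigma>. models_rule \<sigma> (instantiate \<alpha> tv b) \<Longrightarrow> \<exists>n. evals_to_int \<sigma> b n"
    and "step (insert (instantiate \<alpha> tv b) P) S k T"
  shows "step P S k T"
proof -
  from assms(3) obtain s \<beta> \<sigma> Q where s: "s \<in># S" and \<beta>: "\<beta> = instantiate \<alpha> tv b \<or> \<beta> \<in> P"
    and \<sigma>: "vars_rule \<beta> \<subseteq> dom \<sigma>" "fterm_evals_to \<sigma> (lhs \<beta>) s" "models_constr \<sigma> (guard \<beta>)"
      "eval \<sigma> (cost \<beta>) = Some k" "rel_mset (fterm_evals_to \<sigma>) (rhs \<beta>) Q"
    and T: "T = S - {#s#} + Q"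
    unfolding step_def by blast
  show ?thesis
  proof (cases "\<beta> \<in> P")
    case True
    with s \<sigma> T show ?thesis unfolding step_def by blast
  next
    case False
    with \<beta> have \<beta>: "\<beta> = instantiate \<alpha> tv b" by simp
    \<comment> \<open>The side conditions of a step say in particular that \<open>\<sigma>\<close>
      models the instance, which is what integrality of \<open>b\<close> requires.\<close>
    with \<sigma> assms(2) obtain n where n: "evals_to_int \<sigma> b n"
      unfolding models_rule_def by blast
    obtain \<tau> where \<tau>: "vars_rule \<alpha> \<subseteq> dom \<tau>"
      and eq: "eval \<sigma> \<circ> Var(tv := b) = map_option real_of_int \<circ> \<tau>"
      by (rule instantiate_int_substitution[OF \<sigma>(1)[unfolded \<beta>] n])
    \<comment> \<open>Under \<open>\<tau>\<close> the rule \<open>\<alpha>\<close> consumes the same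
      \<open>s\<close> at the same cost \<open>k\<close> and produces the same
      \<open>Q\<close>.\<close>
    from \<sigma>(2-5) have "fterm_evals_to \<tau> (lhs \<alpha>) s" "models_constr \<tau> (guard \<alpha>)"
      "eval \<tau> (cost \<alpha>) = Some k"
      "rel_mset (fterm_evals_to \<tau>) (rhs \<alpha>) Q"
      unfolding \<beta>
      by (simp_all add: instantiate_def subst_rule_def multiset.rel_map fterm_evals_to_subst[OF eq]
          models_constr_subst[OF eq] eval_subst[OF eq])
    with \<tau> s T assms(1) show ?thesis
      unfolding step_def by blast
  qed
qed

lemma steps_mono:
  assumes "\<And>S k T. step P S k T \<Longrightarrow> step R S k T" and "steps P S k T"
  shows "steps R S k T"
  using assms(2) by induction (auto intro: steps.intros assms(1))

lemma rc_mono: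
  assumes "\<And>S k T. step P S k T \<Longrightarrow> step R S k T"
  shows "rc f0 m P n \<le> rc f0 m R n"
proof -
  have "dh P S \<le> dh R S" for S
    unfolding dh_def using steps_mono[OF assms] by (intro Sup_subset_mono) blast
  \<comment> \<open>For \<open>dh\<close> one set of costs contains the other. Here the values
    themselves differ, so each is bounded by its counterpart for the same start term.\<close>
  then show ?thesis
    unfolding rc_def by (intro Sup_mono) blast
qed

theorem theorem3p12:
  fixes Sig :: "'f set" and f0 :: 'f and xs :: "'v list"
    and P P' :: "('f, 'v) program" and \<alpha> :: "('f, 'v) rule"
    and tv :: 'v and b :: "'v aexp"
  assumes "finite Sig" and "f0 \<in> Sig" and "distinct xs"
    and "integer_program Sig f0 xs P"
    and "well_formed_program P"
    and "\<alpha> \<in> P"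
    and "tv \<in> temp_vars xs \<alpha>"
    and "\<And>\<sigma> :: 'v \<rightharpoonup> int. models_rule \<sigma> (instantiate \<alpha> tv b) \<Longrightarrow> \<exists>n. evals_to_int \<sigma> b n"
    and "P' = P \<union> {instantiate \<alpha> tv b}"
  shows "well_formed_program P' \<and> sound_processor Sig f0 xs [P \<mapsto> P']"
proof
  have P': "P' = insert (instantiate \<alpha> tv b) P"
    using assms(9) by simp
  show "well_formed_program P'"
    using assms(5,6) well_formed_rule_instantiate[OF _ assms(8)]
    by (auto simp: P' well_formed_program_def)
  have "integer_program Sig f0 xs P'"
    using integer_program_insert_instantiate assms(4,6,7) by (auto simp: P' temp_vars_def)
  moreover have "rc f0 (length xs) P' n \<le> rc f0 (length xs) P n" for n
    using rc_mono step_insert_instantiate[OF assms(6,8)] unfolding P' by metis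
  \<comment> \<open>The processor is defined at \<open>P\<close> alone, so only the pair of
    \<open>P\<close> and \<open>P'\<close> has to be checked.\<close>
  ultimately show "sound_processor Sig f0 xs [P \<mapsto> P']"
    using assms(4) by (auto simp: sound_processor_def processor_def split: if_splits)
qed

end
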